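(* If $(M,J,\nabla)$ is a special complex manifold then $(M,J,\nabla^\theta)$ is a special complex manifold for any $\theta$. If $(M,J,\nabla,\omega)$ is a special Kähler manifold then $(M,J,\nabla^\theta,\omega)$ is a special Kähler manifold for any $\theta$.
   Context: A special complex manifold $(M,J,\nabla)$ is a complex manifold $(M,J)$ together with a flat torsionfree connection $\nabla$ on its real tangent bundle such that $d^\nabla J=0$, i.e. $(\nabla_XJ)Y=(\nabla_YJ)X$ for all $X,Y$. A special Kähler manifold $(M,J,\nabla,\omega)$ is a special complex manifold together with a $\nabla$-parallel $J$-invariant symplectic form $\omega$. For $\theta\in\mathbb{R}$ the connection $\nabla^\theta$ is defined by $\nabla^\theta X=e^{\theta J}\nabla(e^{-\theta J}X)$, where $e^{\theta J}=(\cos\theta)\mathrm{Id}+(\sin\theta)J$. *)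

theory Defs
  imports "HOL-Analysis.Analysis" "HOL-Library.Function_Algebras"
begin

section \<open>Complex manifolds and their smooth functions\<close>

(* Complex differentiability in several variables: the Frechet derivative exists
   and is complex linear. *)
definition holomorphic_map_on :: "(complex^'n::finite) set \<Rightarrow> (complex^'n \<Rightarrow> complex^'n) \<Rightarrow> bool" where
  "holomorphic_map_on S f \<longleftrightarrow>
     (\<forall>x\<in>S. \<exists>L. (f has_derivative L) (at x) \<and> (\<forall>c v. L (c *s v) = c *s L v))"

(* Meant for open S and a finite-dimensional domain, where it is the usual C^k condition. *)
primrec Ck_on :: "nat \<Rightarrow> 'e::real_normed_vector set \<Rightarrow> ('e \<Rightarrow> real) \<Rightarrow> bool" where
  "Ck_on 0 S f \<longleftrightarrow> continuous_on S f"
| "Ck_on (Suc k) S f \<longleftrightarrow> (\<forall>x\<in>S. f differentiable (at x)) \<and>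
     (\<forall>v. Ck_on k S (\<lambda>x. frechet_derivative f (at x) v))"

definition smooth_on :: "'e::real_normed_vector set \<Rightarrow> ('e \<Rightarrow> real) \<Rightarrow> bool" where
  "smooth_on S f \<longleftrightarrow> (\<forall>k. Ck_on k S f)"

(* A chart (U, \<phi>) has domain U; the values of \<phi> outside U are irrelevant. *)
record ('a, 'n::finite) atlas_space =
  mtop :: "'a topology"
  charts :: "('a set \<times> ('a \<Rightarrow> complex^'n)) set"

abbreviation points :: "('a, 'n::finite) atlas_space \<Rightarrow> 'a set" where
  "points M \<equiv> topspace (mtop M)"

definition holomorphic_atlas :: "('a, 'n::finite) atlas_space \<Rightarrow> bool" where
  "holomorphic_atlas M \<longleftrightarrow>
     (\<Union>(U, \<phi>)\<in>charts M. U) = points M \<and>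
     (\<forall>(U, \<phi>)\<in>charts M. openin (mtop M) U \<and> open (\<phi> ` U) \<and>
        homeomorphic_map (subtopology (mtop M) U) (top_of_set (\<phi> ` U)) \<phi>) \<and>
     (\<forall>(U, \<phi>)\<in>charts M. \<forall>(V, \<psi>)\<in>charts M.
        holomorphic_map_on (\<phi> ` (U \<inter> V)) (\<psi> \<circ> inv_into U \<phi>))"

(* Smooth functions are normalised to vanish off the carrier, so that equality of
   functions on M is equality in HOL. *)
definition smooth_functions :: "('a, 'n::finite) atlas_space \<Rightarrow> ('a \<Rightarrow> real) set" where
  "smooth_functions M =
     {f. (\<forall>p. p \<notin> points M \<longrightarrow> f p = 0) \<and>
         (\<forall>(U, \<phi>)\<in>charts M. smooth_on (\<phi> ` U) (f \<circ> inv_into U \<phi>))}"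


section \<open>Tangent vectors and vector fields\<close>

type_synonym 'a tangent = "('a \<Rightarrow> real) \<Rightarrow> real"
type_synonym 'a vfield = "'a \<Rightarrow> 'a tangent"

definition tscale :: "real \<Rightarrow> 'a tangent \<Rightarrow> 'a tangent" where
  "tscale c v = (\<lambda>f. c * v f)"

definition fscale :: "('a \<Rightarrow> real) \<Rightarrow> 'a vfield \<Rightarrow> 'a vfield" where
  "fscale h X = (\<lambda>p. tscale (h p) (X p))"

(* Derivations at p of the algebra of smooth functions, normalised to be 0 on
   all other functions.  For p outside the carrier this is {0}: multiplying by the
   indicator function of the carrier in the product rule gives v f = 0.  Hence the
   quantifiers over all p below say nothing about points off the carrier. *)
definition tangent_space :: "('a, 'n::finite) atlas_space \<Rightarrow> 'a \<Rightarrow> 'a tangent set" where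
  "tangent_space M p =
     {v. (\<forall>f. f \<notin> smooth_functions M \<longrightarrow> v f = 0) \<and>
         (\<forall>f\<in>smooth_functions M. \<forall>g\<in>smooth_functions M. v (f + g) = v f + v g) \<and>
         (\<forall>f\<in>smooth_functions M. \<forall>c. v (\<lambda>q. c * f q) = c * v f) \<and>
         (\<forall>f\<in>smooth_functions M. \<forall>g\<in>smooth_functions M. v (f * g) = v f * g p + f p * v g)}"

definition vector_fields :: "('a, 'n::finite) atlas_space \<Rightarrow> 'a vfield set" where
  "vector_fields M =
     {X. (\<forall>p. X p \<in> tangent_space M p) \<and>
         (\<forall>f\<in>smooth_functions M. (\<lambda>p. X p f) \<in> smooth_functions M)}"

definition lie_bracket :: "'a vfield \<Rightarrow> 'a vfield \<Rightarrow> 'a vfield" where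
  "lie_bracket X Y = (\<lambda>p f. X p (\<lambda>q. Y q f) - Y p (\<lambda>q. X q f))"

(* The tangent vector at p with coordinate vector \<xi> in the chart (U, \<phi>). *)
definition coord_vector ::
  "('a, 'n::finite) atlas_space \<Rightarrow> 'a set \<Rightarrow> ('a \<Rightarrow> complex^'n) \<Rightarrow> 'a \<Rightarrow> complex^'n \<Rightarrow> 'a tangent" where
  "coord_vector M U \<phi> p \<xi> =
     (\<lambda>f. if f \<in> smooth_functions M
          then frechet_derivative (f \<circ> inv_into U \<phi>) (at (\<phi> p)) \<xi> else 0)"


section \<open>The complex structure\<close>

type_synonym 'a endo = "'a \<Rightarrow> 'a tangent \<Rightarrow> 'a tangent"

definition endo_app :: "'a endo \<Rightarrow> 'a vfield \<Rightarrow> 'a vfield" where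
  "endo_app J X = (\<lambda>p. J p (X p))"

definition smooth_endo :: "('a, 'n::finite) atlas_space \<Rightarrow> 'a endo \<Rightarrow> bool" where
  "smooth_endo M J \<longleftrightarrow>
     (\<forall>p. \<forall>v\<in>tangent_space M p. J p v \<in> tangent_space M p) \<and>
     (\<forall>p. \<forall>v\<in>tangent_space M p. \<forall>w\<in>tangent_space M p. J p (v + w) = J p v + J p w) \<and>
     (\<forall>p. \<forall>v\<in>tangent_space M p. \<forall>c. J p (tscale c v) = tscale c (J p v)) \<and>
     (\<forall>X\<in>vector_fields M. endo_app J X \<in> vector_fields M)"

(* J is the complex structure of M: in each holomorphic chart it is multiplication by i. *)
definition complex_manifold :: "('a, 'n::finite) atlas_space \<Rightarrow> 'a endo \<Rightarrow> bool" where
  "complex_manifold M J \<longleftrightarrow>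
     Hausdorff_space (mtop M) \<and> second_countable (mtop M) \<and> holomorphic_atlas M \<and>
     smooth_endo M J \<and>
     (\<forall>p. \<forall>v\<in>tangent_space M p. J p (J p v) = - v) \<and>
     (\<forall>(U, \<phi>)\<in>charts M. \<forall>p\<in>U. \<forall>\<xi>.
        J p (coord_vector M U \<phi> p \<xi>) = coord_vector M U \<phi> p (\<i> *s \<xi>))"


section \<open>Connections on the real tangent bundle\<close>

(* nabla X Y stands for the covariant derivative of Y in direction X; its values are
   only relevant for smooth vector fields X and Y. *)
type_synonym 'a conn = "'a vfield \<Rightarrow> 'a vfield \<Rightarrow> 'a vfield"

definition connection :: "('a, 'n::finite) atlas_space \<Rightarrow> 'a conn \<Rightarrow> bool" where
  "connection M nabla \<longleftrightarrow>
     (\<forall>X\<in>vector_fields M. \<forall>Y\<in>vector_fields M. nabla X Y \<in> vector_fields M) \<and>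
     (\<forall>X\<in>vector_fields M. \<forall>X'\<in>vector_fields M. \<forall>Y\<in>vector_fields M.
        nabla (X + X') Y = nabla X Y + nabla X' Y) \<and>
     (\<forall>X\<in>vector_fields M. \<forall>Y\<in>vector_fields M. \<forall>f\<in>smooth_functions M.
        nabla (fscale f X) Y = fscale f (nabla X Y)) \<and>
     (\<forall>X\<in>vector_fields M. \<forall>Y\<in>vector_fields M. \<forall>Y'\<in>vector_fields M.
        nabla X (Y + Y') = nabla X Y + nabla X Y') \<and>
     (\<forall>X\<in>vector_fields M. \<forall>Y\<in>vector_fields M. \<forall>c.
        nabla X (fscale (\<lambda>_. c) Y) = fscale (\<lambda>_. c) (nabla X Y)) \<and>
     (\<forall>X\<in>vector_fields M. \<forall>Y\<in>vector_fields M. \<forall>f\<in>smooth_functions M.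
        nabla X (fscale f Y) = fscale (\<lambda>p. X p f) Y + fscale f (nabla X Y))"

definition flat :: "('a, 'n::finite) atlas_space \<Rightarrow> 'a conn \<Rightarrow> bool" where
  "flat M nabla \<longleftrightarrow>
     (\<forall>X\<in>vector_fields M. \<forall>Y\<in>vector_fields M. \<forall>Z\<in>vector_fields M.
        nabla X (nabla Y Z) - nabla Y (nabla X Z) - nabla (lie_bracket X Y) Z = 0)"

definition torsion_free :: "('a, 'n::finite) atlas_space \<Rightarrow> 'a conn \<Rightarrow> bool" where
  "torsion_free M nabla \<longleftrightarrow>
     (\<forall>X\<in>vector_fields M. \<forall>Y\<in>vector_fields M.
        nabla X Y - nabla Y X - lie_bracket X Y = 0)"

definition cov_deriv_endo :: "'a conn \<Rightarrow> 'a endo \<Rightarrow> 'a vfield \<Rightarrow> 'a vfield \<Rightarrow> 'a vfield" where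
  "cov_deriv_endo nabla J X Y = nabla X (endo_app J Y) - endo_app J (nabla X Y)"


section \<open>Special complex and special Kaehler manifolds\<close>

definition special_complex_manifold ::
  "('a, 'n::finite) atlas_space \<Rightarrow> 'a endo \<Rightarrow> 'a conn \<Rightarrow> bool" where
  "special_complex_manifold M J nabla \<longleftrightarrow>
     complex_manifold M J \<and> connection M nabla \<and> flat M nabla \<and> torsion_free M nabla \<and>
     (\<forall>X\<in>vector_fields M. \<forall>Y\<in>vector_fields M.
        cov_deriv_endo nabla J X Y = cov_deriv_endo nabla J Y X)"

type_synonym 'a form2 = "'a \<Rightarrow> 'a tangent \<Rightarrow> 'a tangent \<Rightarrow> real"

definition form_app :: "'a form2 \<Rightarrow> 'a vfield \<Rightarrow> 'a vfield \<Rightarrow> 'a \<Rightarrow> real" where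
  "form_app \<omega> X Y = (\<lambda>p. \<omega> p (X p) (Y p))"

definition smooth_2form :: "('a, 'n::finite) atlas_space \<Rightarrow> 'a form2 \<Rightarrow> bool" where
  "smooth_2form M \<omega> \<longleftrightarrow>
     (\<forall>p. \<forall>u\<in>tangent_space M p. \<forall>v\<in>tangent_space M p. \<forall>w\<in>tangent_space M p.
        \<omega> p (u + v) w = \<omega> p u w + \<omega> p v w) \<and>
     (\<forall>p. \<forall>v\<in>tangent_space M p. \<forall>w\<in>tangent_space M p. \<forall>c. \<omega> p (tscale c v) w = c * \<omega> p v w) \<and>
     (\<forall>p. \<forall>v\<in>tangent_space M p. \<forall>w\<in>tangent_space M p. \<omega> p v w = - \<omega> p w v) \<and>
     (\<forall>X\<in>vector_fields M. \<forall>Y\<in>vector_fields M. form_app \<omega> X Y \<in> smooth_functions M)"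

definition nondegenerate :: "('a, 'n::finite) atlas_space \<Rightarrow> 'a form2 \<Rightarrow> bool" where
  "nondegenerate M \<omega> \<longleftrightarrow>
     (\<forall>p. \<forall>v\<in>tangent_space M p. (\<forall>w\<in>tangent_space M p. \<omega> p v w = 0) \<longrightarrow> v = 0)"

(* The invariant formula for the exterior derivative of a 2-form. *)
definition closed_2form :: "('a, 'n::finite) atlas_space \<Rightarrow> 'a form2 \<Rightarrow> bool" where
  "closed_2form M \<omega> \<longleftrightarrow>
     (\<forall>X\<in>vector_fields M. \<forall>Y\<in>vector_fields M. \<forall>Z\<in>vector_fields M. \<forall>p.
        X p (form_app \<omega> Y Z) + Y p (form_app \<omega> Z X) + Z p (form_app \<omega> X Y)
        - form_app \<omega> (lie_bracket X Y) Z p - form_app \<omega> (lie_bracket Y Z) X p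
        - form_app \<omega> (lie_bracket Z X) Y p = 0)"

definition symplectic_form :: "('a, 'n::finite) atlas_space \<Rightarrow> 'a form2 \<Rightarrow> bool" where
  "symplectic_form M \<omega> \<longleftrightarrow> smooth_2form M \<omega> \<and> nondegenerate M \<omega> \<and> closed_2form M \<omega>"

definition parallel_form :: "('a, 'n::finite) atlas_space \<Rightarrow> 'a conn \<Rightarrow> 'a form2 \<Rightarrow> bool" where
  "parallel_form M nabla \<omega> \<longleftrightarrow>
     (\<forall>X\<in>vector_fields M. \<forall>Y\<in>vector_fields M. \<forall>Z\<in>vector_fields M. \<forall>p.
        X p (form_app \<omega> Y Z) - form_app \<omega> (nabla X Y) Z p - form_app \<omega> Y (nabla X Z) p = 0)"

definition J_invariant :: "('a, 'n::finite) atlas_space \<Rightarrow> 'a endo \<Rightarrow> 'a form2 \<Rightarrow> bool" where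
  "J_invariant M J \<omega> \<longleftrightarrow>
     (\<forall>p. \<forall>v\<in>tangent_space M p. \<forall>w\<in>tangent_space M p. \<omega> p (J p v) (J p w) = \<omega> p v w)"

(* No positivity is required: the associated metric may be indefinite. *)
definition special_kaehler_manifold ::
  "('a, 'n::finite) atlas_space \<Rightarrow> 'a endo \<Rightarrow> 'a conn \<Rightarrow> 'a form2 \<Rightarrow> bool" where
  "special_kaehler_manifold M J nabla \<omega> \<longleftrightarrow>
     special_complex_manifold M J nabla \<and>
     symplectic_form M \<omega> \<and> J_invariant M J \<omega> \<and> parallel_form M nabla \<omega>"


section \<open>The rotated connections\<close>

definition exp_J :: "real \<Rightarrow> 'a endo \<Rightarrow> 'a endo" where
  "exp_J \<theta> J = (\<lambda>p v. tscale (cos \<theta>) v + tscale (sin \<theta>) (J p v))"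

definition conn_theta :: "real \<Rightarrow> 'a endo \<Rightarrow> 'a conn \<Rightarrow> 'a conn" where
  "conn_theta \<theta> J nabla = (\<lambda>X Y. endo_app (exp_J \<theta> J) (nabla X (endo_app (exp_J (- \<theta>) J) Y)))"

end

theory Submission
  imports Defs
begin

text \<open>
  Put \<open>A X Y = (\<nabla>\<^sub>X J) Y\<close>.  Differentiating \<open>J\<^sup>2 = -1\<close> shows that \<open>A X\<close> anticommutes with \<open>J\<close>,
  so \<open>A X (e\<^bsup>-\<theta>J\<^esup> Y) = e\<^bsup>\<theta>J\<^esup> (A X Y)\<close>.  It follows that \<open>\<nabla>\<^bsup>\<theta>\<^esup>\<^sub>X Y = \<nabla>\<^sub>X Y - sin \<theta> \<cdot> e\<^bsup>\<theta>J\<^esup> (A X Y)\<close> and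
  \<open>(\<nabla>\<^bsup>\<theta>\<^esup>\<^sub>X J) Y = e\<^bsup>2\<theta>J\<^esup> (A X Y)\<close>.  Since \<open>A\<close> is symmetric, the torsion does not change and
  \<open>\<nabla>\<^bsup>\<theta>\<^esup> J\<close> is again symmetric.  Flatness is preserved because \<open>\<nabla>\<^bsup>\<theta>\<^esup>\<close> is conjugate to \<open>\<nabla>\<close>, and a
  \<open>J\<close>-invariant form is \<open>e\<^bsup>\<theta>J\<^esup>\<close>-invariant, hence parallel for \<open>\<nabla>\<close> and \<open>\<nabla>\<^bsup>\<theta>\<^esup>\<close> at the same time.
\<close>

section \<open>Linear operations on smooth functions and vector fields\<close>

text \<open>Values on an open set determine the derivatives there. This is needed because the
  derivative of a sum or multiple is computed only at points of \<open>S\<close>.\<close>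

lemma Ck_on_cong:
  assumes "open S" and "\<And>x. x \<in> S \<Longrightarrow> f x = g x" and "Ck_on k S f"
  shows "Ck_on k S g"
  using assms(2,3)
proof (induction k arbitrary: f g)
  case 0
  then show ?case
    by (metis Ck_on.simps(1) continuous_on_cong)
next
  case (Suc k)
  have g: "(g has_derivative frechet_derivative f (at x)) (at x)" if "x \<in> S" for x
    using Suc.prems that assms(1)
    by (auto simp: frechet_derivative_works intro: has_derivative_transform_within_open)
  then have eq: "frechet_derivative g (at x) = frechet_derivative f (at x)" if "x \<in> S" for x
    using that by (metis frechet_derivative_at)
  have "Ck_on k S (\<lambda>x. frechet_derivative g (at x) v)" for v
  proof (rule Suc.IH)
    show "Ck_on k S (\<lambda>x. frechet_derivative f (at x) v)"
      using Suc.prems(2) by simp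
    show "frechet_derivative f (at x) v = frechet_derivative g (at x) v" if "x \<in> S" for x
      by (simp only: eq[OF that])
  qed
  moreover have "\<forall>x\<in>S. g differentiable (at x)"
    using g by (blast intro: differentiableI)
  ultimately show ?case
    by (simp only: Ck_on.simps) blast
qed

lemma Ck_on_add:
  assumes "open S" and "Ck_on k S f" and "Ck_on k S g"
  shows "Ck_on k S (\<lambda>x. f x + g x)"
  using assms(2,3)
proof (induction k arbitrary: f g)
  case 0
  then show ?case
    by (auto intro: continuous_on_add)
next
  case (Suc k)
  have "Ck_on k S (\<lambda>x. frechet_derivative (\<lambda>x. f x + g x) (at x) v)" for v
  proof (rule Ck_on_cong[OF \<open>open S\<close>])
    show "Ck_on k S (\<lambda>x. frechet_derivative f (at x) v + frechet_derivative g (at x) v)"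
      using Suc by auto
    show "frechet_derivative f (at x) v + frechet_derivative g (at x) v =
        frechet_derivative (\<lambda>x. f x + g x) (at x) v" if "x \<in> S" for x
    proof -
      have "((\<lambda>x. f x + g x) has_derivative
          (\<lambda>v. frechet_derivative f (at x) v + frechet_derivative g (at x) v)) (at x)"
        using Suc.prems that by (auto simp: frechet_derivative_works intro: has_derivative_add)
      from fun_cong[OF frechet_derivative_at[OF this], of v] show ?thesis .
    qed
  qed
  with Suc.prems show ?case
    by auto
qed

lemma Ck_on_cmult:
  assumes "open S" and "Ck_on k S f"
  shows "Ck_on k S (\<lambda>x. c * f x)"
  using assms(2)
proof (induction k arbitrary: f)
  case 0
  then show ?case
    by (auto intro: continuous_intros)
next
  case (Suc k)
  have "Ck_on k S (\<lambda>x. frechet_derivative (\<lambda>x. c * f x) (at x) v)" for v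
  proof (rule Ck_on_cong[OF \<open>open S\<close>])
    show "Ck_on k S (\<lambda>x. c * frechet_derivative f (at x) v)"
      using Suc by auto
    show "c * frechet_derivative f (at x) v = frechet_derivative (\<lambda>x. c * f x) (at x) v"
      if "x \<in> S" for x
    proof -
      have "((\<lambda>x. c * f x) has_derivative (\<lambda>v. c * frechet_derivative f (at x) v)) (at x)"
        using Suc.prems that
        by (auto simp: frechet_derivative_works intro: has_derivative_mult_right)
      from fun_cong[OF frechet_derivative_at[OF this], of v] show ?thesis .
    qed
  qed
  with Suc.prems show ?case
    by auto
qed

lemma smooth_functions_add:
  assumes "holomorphic_atlas M" and "f \<in> smooth_functions M" and "g \<in> smooth_functions M"
  shows "(\<lambda>p. f p + g p) \<in> smooth_functions M"
  using assms
  by (fastforce simp: smooth_functions_def smooth_on_def holomorphic_atlas_def comp_def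
      intro: Ck_on_add)

lemma smooth_functions_cmult:
  assumes "holomorphic_atlas M" and "f \<in> smooth_functions M"
  shows "(\<lambda>p. c * f p) \<in> smooth_functions M"
  using assms
  by (fastforce simp: smooth_functions_def smooth_on_def holomorphic_atlas_def comp_def
      intro: Ck_on_cmult)

lemma tangent_space_add:
  assumes "v \<in> tangent_space M p" and "w \<in> tangent_space M p"
  shows "v + w \<in> tangent_space M p"
  using assms by (simp add: tangent_space_def algebra_simps)

lemma tangent_space_tscale:
  assumes "v \<in> tangent_space M p"
  shows "tscale c v \<in> tangent_space M p"
  using assms by (simp add: tangent_space_def tscale_def algebra_simps)

lemma vector_fields_tangent:
  "X \<in> vector_fields M \<Longrightarrow> X p \<in> tangent_space M p"
  by (simp add: vector_fields_def)

lemma vector_fields_add: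
  assumes "holomorphic_atlas M" and "X \<in> vector_fields M" and "Y \<in> vector_fields M"
  shows "X + Y \<in> vector_fields M"
  using assms by (simp add: vector_fields_def tangent_space_add smooth_functions_add)

text \<open>Constants need not lie in \<open>smooth_functions\<close>, whose members vanish off the
  carrier, so constant factors are treated separately.\<close>

lemma vector_fields_cscale:
  assumes "holomorphic_atlas M" and "X \<in> vector_fields M"
  shows "fscale (\<lambda>_. c) X \<in> vector_fields M"
  using assms
  by (simp add: vector_fields_def fscale_def tangent_space_tscale)
    (simp add: tscale_def smooth_functions_cmult)

lemmas vfield_pointwise = fun_eq_iff fscale_def tscale_def endo_app_def algebra_simps

section \<open>The rotations \<open>exp_J \<theta> J\<close> acting on vector fields\<close>

locale complex_mfd =
  fixes M :: "('a, 'n::finite) atlas_space" and J :: "'a endo"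
  assumes complex_manifold: "complex_manifold M J"
begin

abbreviation rot :: "real \<Rightarrow> 'a vfield \<Rightarrow> 'a vfield" where
  "rot \<theta> X \<equiv> endo_app (exp_J \<theta> J) X"

lemma holomorphic_atlas: "holomorphic_atlas M"
  using complex_manifold by (simp add: complex_manifold_def)

lemmas vf_add = vector_fields_add[OF holomorphic_atlas]
lemmas vf_cscale = vector_fields_cscale[OF holomorphic_atlas]

lemma
  assumes "v \<in> tangent_space M p"
  shows J_tangent: "J p v \<in> tangent_space M p"
    and J_tscale: "J p (tscale c v) = tscale c (J p v)"
    and J_J: "J p (J p v) = - v"
    and J_add: "w \<in> tangent_space M p \<Longrightarrow> J p (v + w) = J p v + J p w"
  using complex_manifold assms by (auto simp: complex_manifold_def smooth_endo_def)

lemma J_vf: "X \<in> vector_fields M \<Longrightarrow> endo_app J X \<in> vector_fields M"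
  using complex_manifold by (auto simp: complex_manifold_def smooth_endo_def)

lemma J_vf_add:
  "X \<in> vector_fields M \<Longrightarrow> Y \<in> vector_fields M \<Longrightarrow>
    endo_app J (X + Y) = endo_app J X + endo_app J Y"
  by (simp add: endo_app_def fun_eq_iff J_add[unfolded fun_eq_iff] vector_fields_tangent)

lemma J_vf_fscale:
  "X \<in> vector_fields M \<Longrightarrow> endo_app J (fscale h X) = fscale h (endo_app J X)"
  by (simp add: endo_app_def fscale_def J_tscale vector_fields_tangent)

lemma J_vf_J: "X \<in> vector_fields M \<Longrightarrow> endo_app J (endo_app J X) = - X"
  by (simp add: endo_app_def fun_eq_iff J_J vector_fields_tangent)

lemma rot_eq: "rot \<theta> X = fscale (\<lambda>_. cos \<theta>) X + fscale (\<lambda>_. sin \<theta>) (endo_app J X)"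
  by (simp add: vfield_pointwise exp_J_def)

lemma rot_vf: "X \<in> vector_fields M \<Longrightarrow> rot \<theta> X \<in> vector_fields M"
  by (simp add: rot_eq vf_add vf_cscale J_vf)

lemma rot_add:
  "X \<in> vector_fields M \<Longrightarrow> Y \<in> vector_fields M \<Longrightarrow> rot \<theta> (X + Y) = rot \<theta> X + rot \<theta> Y"
  by (simp add: rot_eq J_vf_add) (simp add: vfield_pointwise)

lemma rot_fscale: "X \<in> vector_fields M \<Longrightarrow> rot \<theta> (fscale h X) = fscale h (rot \<theta> X)"
  by (simp add: rot_eq J_vf_fscale) (simp add: vfield_pointwise)

text \<open>With arbitrary coefficients the summands need not be smooth fields, so
  \<open>rot_add\<close> does not apply and the argument is pointwise. It serves the Leibniz rule
  and differences of fields.\<close>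

lemma rot_linear:
  assumes "X \<in> vector_fields M" and "Y \<in> vector_fields M"
  shows "rot \<theta> (fscale h X + fscale k Y) = fscale h (rot \<theta> X) + fscale k (rot \<theta> Y)"
proof -
  have "endo_app J (fscale h X + fscale k Y) = fscale h (endo_app J X) + fscale k (endo_app J Y)"
    using assms
    by (simp add: endo_app_def fscale_def fun_eq_iff J_add J_tscale tangent_space_tscale
        vector_fields_tangent)
  then show ?thesis
    by (simp add: rot_eq) (simp add: vfield_pointwise)
qed

lemma J_rot: "X \<in> vector_fields M \<Longrightarrow> endo_app J (rot \<theta> X) = rot \<theta> (endo_app J X)"
  by (simp add: rot_eq J_vf_add J_vf_fscale vf_cscale J_vf)

lemma rot_rot: "X \<in> vector_fields M \<Longrightarrow> rot a (rot b X) = rot (a + b) X"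
  \<comment> \<open>Only the outer rotation is expanded at first, so that \<open>J\<close> moves
    inside the other one and meets \<open>X\<close> directly; then \<open>J\<^sup>2 = -1\<close> and
    the addition formulas finish.\<close>
  by (simp add: rot_eq[of a] J_rot)
    (simp add: rot_eq[of b] rot_eq[of "a + b"] J_vf_J,
      simp add: vfield_pointwise cos_add sin_add)

lemma rot_0: "rot 0 X = X"
  by (simp add: rot_eq) (simp add: vfield_pointwise)

lemma rot_inverse:
  assumes "X \<in> vector_fields M"
  shows "rot \<theta> (rot (- \<theta>) X) = X" and "rot (- \<theta>) (rot \<theta> X) = X"
  using assms by (simp_all add: rot_rot rot_0)

end

section \<open>Connections and the covariant derivative of \<open>J\<close>\<close>

locale connection_mfd = complex_mfd M J
  for M :: "('a, 'n::finite) atlas_space" and J :: "'a endo" +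
  fixes nabla :: "'a conn"
  assumes connection: "connection M nabla"
begin

lemma
  assumes "X \<in> vector_fields M" and "Y \<in> vector_fields M"
  shows nabla_vf: "nabla X Y \<in> vector_fields M"
    and nabla_add_left: "X' \<in> vector_fields M \<Longrightarrow> nabla (X + X') Y = nabla X Y + nabla X' Y"
    and nabla_add: "Y' \<in> vector_fields M \<Longrightarrow> nabla X (Y + Y') = nabla X Y + nabla X Y'"
    and nabla_fscale_left: "f \<in> smooth_functions M \<Longrightarrow> nabla (fscale f X) Y = fscale f (nabla X Y)"
    and nabla_cscale: "nabla X (fscale (\<lambda>_. c) Y) = fscale (\<lambda>_. c) (nabla X Y)"
    and nabla_fscale: "f \<in> smooth_functions M \<Longrightarrow>
      nabla X (fscale f Y) = fscale (\<lambda>p. X p f) Y + fscale f (nabla X Y)"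
  using connection assms by (auto simp: connection_def)

abbreviation A :: "'a vfield \<Rightarrow> 'a vfield \<Rightarrow> 'a vfield" where
  "A \<equiv> cov_deriv_endo nabla J"

abbreviation nabla_rot :: "real \<Rightarrow> 'a vfield \<Rightarrow> 'a vfield \<Rightarrow> 'a vfield" where
  "nabla_rot \<theta> \<equiv> conn_theta \<theta> J nabla"

lemma nabla_uminus:
  assumes "X \<in> vector_fields M" and "Y \<in> vector_fields M"
  shows "nabla X (- Y) = - nabla X Y"
proof -
  have "- Z = fscale (\<lambda>_. - 1) Z" for Z :: "'a vfield"
    by (simp add: vfield_pointwise)
  then show ?thesis
    using nabla_cscale[OF assms, of "- 1"] by simp
qed

lemma A_vf:
  assumes "X \<in> vector_fields M" and "Y \<in> vector_fields M"
  shows "A X Y \<in> vector_fields M"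
proof -
  have "A X Y = nabla X (endo_app J Y) + fscale (\<lambda>_. - 1) (endo_app J (nabla X Y))"
    by (simp add: cov_deriv_endo_def vfield_pointwise)
  then show ?thesis
    using assms by (simp add: vf_add vf_cscale nabla_vf J_vf)
qed

lemma nabla_J:
  "nabla X (endo_app J Y) = A X Y + endo_app J (nabla X Y)"
  by (simp add: cov_deriv_endo_def)

text \<open>Here \<open>J (J Y) = - Y\<close> turns the first term of \<open>A X (J Y)\<close> into
  \<open>- nabla X Y\<close>, which cancels against the same term in the expansion of the
  second.\<close>

lemma A_J:
  assumes "X \<in> vector_fields M" and "Y \<in> vector_fields M"
  shows "A X (endo_app J Y) = - endo_app J (A X Y)"
proof -
  have "A X (endo_app J Y) = - nabla X Y - endo_app J (nabla X (endo_app J Y))"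
    using assms by (simp add: cov_deriv_endo_def[of _ _ _ "endo_app J Y"] J_vf_J nabla_uminus)
  also have "\<dots> = - endo_app J (A X Y)"
    using assms by (simp add: nabla_J J_vf_add A_vf J_vf nabla_vf J_vf_J)
  finally show ?thesis .
qed

text \<open>Leibniz rule for \<open>exp_J \<theta> J\<close>: as \<open>cos \<theta>\<close> and
  \<open>sin \<theta>\<close> are constant, its covariant derivative is \<open>sin \<theta>\<close>
  times that of \<open>J\<close>.\<close>

lemma nabla_rotated:
  assumes "X \<in> vector_fields M" and "Y \<in> vector_fields M"
  shows "nabla X (rot \<theta> Y) = rot \<theta> (nabla X Y) + fscale (\<lambda>_. sin \<theta>) (A X Y)"
proof -
  have "nabla X (rot \<theta> Y) =
      fscale (\<lambda>_. cos \<theta>) (nabla X Y) + fscale (\<lambda>_. sin \<theta>) (nabla X (endo_app J Y))"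
    using assms by (simp add: rot_eq nabla_add nabla_cscale vf_cscale J_vf)
  then show ?thesis
    by (simp add: nabla_J rot_eq) (simp add: vfield_pointwise)
qed

lemma A_rot:
  assumes "X \<in> vector_fields M" and "Y \<in> vector_fields M"
  shows "A X (rot \<theta> Y) = rot (- \<theta>) (A X Y)"
proof -
  have "A X (rot \<theta> Y) = nabla X (rot \<theta> (endo_app J Y)) - endo_app J (nabla X (rot \<theta> Y))"
    using assms by (simp add: cov_deriv_endo_def J_rot)
  \<comment> \<open>One \<open>sin \<theta>\<close> comes from
    \<open>A X (J Y) = - J (A X Y)\<close>, the other from the \<open>A\<close> term of
    \<open>nabla X (rot \<theta> Y)\<close>. Together they flip the sign of the sine part.\<close>
  also have "\<dots> = rot \<theta> (A X Y) - fscale (\<lambda>_. 2 * sin \<theta>) (endo_app J (A X Y))"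
    using assms
    by (simp add: nabla_rotated A_J nabla_J rot_add J_vf_add J_vf_fscale J_rot
        A_vf J_vf nabla_vf rot_vf vf_cscale) (simp add: vfield_pointwise)
  also have "\<dots> = rot (- \<theta>) (A X Y)"
    by (simp add: rot_eq) (simp add: vfield_pointwise)
  finally show ?thesis .
qed

text \<open>The two connections differ by a tensor that is symmetric whenever \<open>A\<close> is,
  which gives equality of torsions.\<close>

lemma nabla_rot_eq:
  assumes "X \<in> vector_fields M" and "Y \<in> vector_fields M"
  shows "nabla_rot \<theta> X Y = nabla X Y + fscale (\<lambda>_. - sin \<theta>) (rot \<theta> (A X Y))"
  using assms
  by (simp add: conn_theta_def nabla_rotated rot_add rot_fscale rot_inverse
      A_vf nabla_vf rot_vf vf_cscale)

text \<open>Passing \<open>rot (- \<theta>)\<close> out of \<open>A X\<close> reverses its angle,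
  and it joins the outer \<open>rot \<theta>\<close>; hence the double angle.\<close>

lemma cov_deriv_nabla_rot:
  assumes "X \<in> vector_fields M" and "Y \<in> vector_fields M"
  shows "cov_deriv_endo (nabla_rot \<theta>) J X Y = rot (2 * \<theta>) (A X Y)"
proof -
  have "nabla X (rot (- \<theta>) (endo_app J Y)) =
      A X (rot (- \<theta>) Y) + endo_app J (nabla X (rot (- \<theta>) Y))"
    using assms by (simp add: nabla_J flip: J_rot)
  then have "cov_deriv_endo (nabla_rot \<theta>) J X Y = rot \<theta> (A X (rot (- \<theta>) Y))"
    using assms
    unfolding cov_deriv_endo_def[of "nabla_rot \<theta>"]
    unfolding conn_theta_def
    by (simp add: rot_add J_rot A_vf J_vf nabla_vf rot_vf)
  then show ?thesis
    using assms by (simp add: A_rot rot_rot A_vf)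
qed

section \<open>The special complex structure of the rotated connection\<close>

lemma connection_nabla_rot: "connection M (nabla_rot \<theta>)"
  unfolding connection_def conn_theta_def
  by (simp add: rot_vf nabla_vf nabla_add_left rot_add nabla_fscale_left rot_fscale nabla_add
      nabla_cscale nabla_fscale rot_linear rot_inverse)

lemma flat_nabla_rot:
  assumes "flat M nabla"
  shows "flat M (nabla_rot \<theta>)"
  unfolding flat_def
proof (intro ballI)
  fix X Y Z assume vf: "X \<in> vector_fields M" "Y \<in> vector_fields M" "Z \<in> vector_fields M"
  let ?W = "rot (- \<theta>) Z"
  have W: "?W \<in> vector_fields M"
    using vf by (simp add: rot_vf)
  \<comment> \<open>Solving for the bracket term expresses it through fields known to be smooth, as
    splitting \<open>rot\<close> over the difference requires.\<close>
  have "nabla (lie_bracket X Y) ?W = nabla X (nabla Y ?W) - nabla Y (nabla X ?W)"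
    using assms vf W by (simp add: flat_def)
  moreover have "rot \<theta> (V - V') = rot \<theta> V - rot \<theta> V'"
    if "V \<in> vector_fields M" "V' \<in> vector_fields M" for V V'
  proof -
    have diff: "S - S' = fscale (\<lambda>_. 1) S + fscale (\<lambda>_. - 1) S'" for S S' :: "'a vfield"
      by (simp add: vfield_pointwise)
    show ?thesis
      unfolding diff using that by (rule rot_linear)
  qed
  ultimately show
    "nabla_rot \<theta> X (nabla_rot \<theta> Y Z) - nabla_rot \<theta> Y (nabla_rot \<theta> X Z)
      - nabla_rot \<theta> (lie_bracket X Y) Z = 0"
    using vf W by (simp add: conn_theta_def rot_inverse nabla_vf)
qed

lemma torsion_free_nabla_rot:
  assumes "torsion_free M nabla"
    and "\<And>X Y. X \<in> vector_fields M \<Longrightarrow> Y \<in> vector_fields M \<Longrightarrow> A X Y = A Y X"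
  shows "torsion_free M (nabla_rot \<theta>)"
  using assms by (simp add: torsion_free_def nabla_rot_eq)

lemma special_complex_nabla_rot:
  assumes "special_complex_manifold M J nabla"
  shows "special_complex_manifold M J (nabla_rot \<theta>)"
  using assms
  by (simp add: special_complex_manifold_def connection_nabla_rot flat_nabla_rot
      torsion_free_nabla_rot cov_deriv_nabla_rot)

section \<open>Invariant forms and parallelism\<close>

text \<open>Invariance makes \<open>J\<close> skew-adjoint for \<open>\<omega>\<close>, so the mixed
  terms cancel and \<open>cos\<^sup>2 + sin\<^sup>2 = 1\<close> remains.\<close>

lemma form_rot:
  assumes \<omega>: "smooth_2form M \<omega>" "J_invariant M J \<omega>"
    and vf: "X \<in> vector_fields M" "Y \<in> vector_fields M"
  shows "form_app \<omega> (rot \<theta> X) (rot \<theta> Y) = form_app \<omega> X Y"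
proof
  fix p
  let ?T = "tangent_space M p"
  define v w where "v = X p" and "w = Y p"
  have T: "v \<in> ?T" "w \<in> ?T"
    using vf by (simp_all add: v_def w_def vector_fields_tangent)
  have add_left: "\<omega> p (u + u') z = \<omega> p u z + \<omega> p u' z"
    if "u \<in> ?T" "u' \<in> ?T" "z \<in> ?T" for u u' z
    using \<omega> that unfolding smooth_2form_def by blast
  have scale_left: "\<omega> p (tscale c u) z = c * \<omega> p u z"
    and skew: "\<omega> p u z = - \<omega> p z u"
    and inv: "\<omega> p (J p u) (J p z) = \<omega> p u z"
    if "u \<in> ?T" "z \<in> ?T" for u z c
    using \<omega> that unfolding smooth_2form_def J_invariant_def by blast+
  \<comment> \<open>\<open>smooth_2form\<close> states linearity in the first argument;
    skew-symmetry carries it to the second.\<close>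
  have add_right: "\<omega> p z (u + u') = \<omega> p z u + \<omega> p z u'"
    if "u \<in> ?T" "u' \<in> ?T" "z \<in> ?T" for u u' z
    using that add_left[of u u' z] skew[of z u] skew[of z u'] skew[of z "u + u'"]
    by (simp add: tangent_space_add)
  have scale_right: "\<omega> p z (tscale c u) = c * \<omega> p z u"
    if "u \<in> ?T" "z \<in> ?T" for u z c
    using that scale_left[of u z c] skew[of z u] skew[of z "tscale c u"]
    by (simp add: tangent_space_tscale)
  have "\<omega> p (J p v) w = - \<omega> p v (J p w)"
  proof -
    \<comment> \<open>Invariance is applied to the pair \<open>J p v\<close>, \<open>w\<close>,
      where \<open>J p (J p v) = - v\<close>.\<close>
    have "\<omega> p (J p v) w = \<omega> p (tscale (- 1) v) (J p w)"
      using T inv[of "J p v" w] by (simp add: J_J J_tangent tscale_def fun_Compl_def)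
    then show ?thesis
      using T by (simp add: scale_left J_tangent)
  qed
  moreover have "cos \<theta> * (cos \<theta> * x) + sin \<theta> * (sin \<theta> * x) = x" for x
    using sin_cos_squared_add[of \<theta>] by algebra
  ultimately show "form_app \<omega> (rot \<theta> X) (rot \<theta> Y) p = form_app \<omega> X Y p"
    using T unfolding form_app_def endo_app_def exp_J_def v_def[symmetric] w_def[symmetric]
    by (simp add: add_left add_right scale_left scale_right inv J_tangent tangent_space_add
        tangent_space_tscale right_diff_distrib distrib_left mult.left_commute)
qed

lemma parallel_nabla_rot:
  assumes \<omega>: "smooth_2form M \<omega>" "J_invariant M J \<omega>" and par: "parallel_form M nabla \<omega>"
  shows "parallel_form M (nabla_rot \<theta>) \<omega>"
  unfolding parallel_form_def
proof (intro ballI allI)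
  fix X Y Z p assume vf: "X \<in> vector_fields M" "Y \<in> vector_fields M" "Z \<in> vector_fields M"
  \<comment> \<open>The adjoint of an isometry is its inverse; this moves the outer rotation of
    \<open>nabla_rot \<theta>\<close> to the other argument.\<close>
  have adjoint: "form_app \<omega> (rot \<theta> V) W = form_app \<omega> V (rot (- \<theta>) W)"
      "form_app \<omega> W (rot \<theta> V) = form_app \<omega> (rot (- \<theta>) W) V"
    if "V \<in> vector_fields M" "W \<in> vector_fields M" for V W
    using that form_rot[OF \<omega>, of V "rot (- \<theta>) W" \<theta>] form_rot[OF \<omega>, of "rot (- \<theta>) W" V \<theta>]
    by (simp_all add: rot_inverse rot_vf)
  have "X p (form_app \<omega> (rot (- \<theta>) Y) (rot (- \<theta>) Z))
      - form_app \<omega> (nabla X (rot (- \<theta>) Y)) (rot (- \<theta>) Z) p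
      - form_app \<omega> (rot (- \<theta>) Y) (nabla X (rot (- \<theta>) Z)) p = 0"
    using par vf by (simp add: parallel_form_def rot_vf)
  then show "X p (form_app \<omega> Y Z) - form_app \<omega> (nabla_rot \<theta> X Y) Z p
      - form_app \<omega> Y (nabla_rot \<theta> X Z) p = 0"
    using vf by (simp add: conn_theta_def form_rot[OF \<omega>] adjoint nabla_vf rot_vf)
qed

end

theorem corollary2:
  fixes M :: "('a, 'n::finite) atlas_space"
    and J :: "'a endo"
    and nabla :: "'a conn"
    and \<omega> :: "'a form2"
  shows "(special_complex_manifold M J nabla \<longrightarrow>
            (\<forall>\<theta>. special_complex_manifold M J (conn_theta \<theta> J nabla))) \<and>
         (special_kaehler_manifold M J nabla \<omega> \<longrightarrow>
            (\<forall>\<theta>. special_kaehler_manifold M J (conn_theta \<theta> J nabla) \<omega>))"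
proof -
  have mfd: "connection_mfd M J nabla" if "special_complex_manifold M J nabla"
    using that by unfold_locales (auto simp: special_complex_manifold_def)
  then show ?thesis
    \<comment> \<open>The symplectic and \<open>J\<close>-invariance conditions do not involve the
      connection, so parallelism is the only further condition on \<open>\<omega>\<close> to
      transfer.\<close>
    by (auto simp: special_kaehler_manifold_def symplectic_form_def
        intro: connection_mfd.special_complex_nabla_rot connection_mfd.parallel_nabla_rot)
qed

end
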